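(* For every $x \in (0, \pi/2)$, the double inequality $$\frac{2 + \cos x}{3} - \left(\frac{2}{3} - \frac{2}{\pi}\right)\Psi_1(x) < \frac{\sin x}{x} < \frac{2 + \cos x}{3} - \left(\frac{2}{3} - \frac{2}{\pi}\right)\Psi_2(x)$$ holds, where $\Psi_1(x) := \sin x - x \cos x$ and $\Psi_2(x) := (\sin x - x \cos x)^2$.
   Context: All functions are real-valued functions of a real variable. *)

theory Defs
  imports Complex_Main
begin

definition Psi1 :: "real \<Rightarrow> real" where
  "Psi1 x = sin x - x * cos x"

definition Psi2 :: "real \<Rightarrow> real" where
  "Psi2 x = (sin x - x * cos x)\<^sup>2"

end

theory Submission
  imports Defs
begin

text \<open>
  Put \<open>\<Psi> x = sin x - x cos x\<close>, \<open>g x = 2 x + x cos x - 3 sin x\<close> and \<open>K = 2 - 6 / \<pi>\<close>. After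
  multiplication by \<open>3 x\<close> the two inequalities say that \<open>K x (\<Psi> x)\<^sup>2 < g x < K x \<Psi> x\<close> on
  \<open>(0, \<pi>/2)\<close>. The constant \<open>K\<close> is the one for which both become equalities at \<open>\<pi>/2\<close>; they are
  also equalities at \<open>0\<close>. So each difference \<open>f\<close>, namely \<open>g - K x \<Psi>\<close> and \<open>K x \<Psi>\<^sup>2 - g\<close>, vanishes
  at both ends, and it has to be negative in between.

  This follows from a sign pattern that passes from a derivative to its primitive. Say that a
  function crosses upwards on \<open>(0, b]\<close> if it is positive at every point after a point where it is
  nonnegative. If \<open>f 0 = 0\<close> and \<open>f'\<close> crosses upwards, so does \<open>f\<close>: wherever \<open>f\<close> is
  nonnegative it has already begun to climb, and then it goes on climbing. A function that
  crosses upwards and vanishes at \<open>b\<close> is negative on \<open>(0, b)\<close>. The functions \<open>f\<close> and all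
  their derivatives in question vanish at \<open>0\<close>, so it suffices to find
  one that crosses upwards, and a positive function times a strictly increasing one does:

  \<^item> the third derivative of \<open>g - K x \<Psi>\<close> is \<open>sin x\<close> times
    \<open>x + K x\<^sup>2 - 3 K - 5 K x cot x\<close>, which increases because \<open>x cot x\<close> decreases;

  \<^item> the second derivative of \<open>K x \<Psi>\<^sup>2 - g\<close> is \<open>\<Psi> x\<close> times
    \<open>K (6 x sin x + 2 x\<^sup>2 cos x + 2 x\<^sup>3 sin\<^sup>2 x / \<Psi> x) - 1\<close>. The quotient increases by the
    estimate \<open>x cot x < 1 - x\<^sup>2 / 3\<close>, which also gives \<open>x\<^sup>2 < 3\<close> for \<open>x \<le> \<pi>/2\<close>, and with it
    the growth of the remaining terms.

  The only numerical input is \<open>K > 0\<close>, that is \<open>\<pi> > 3\<close>, which is \<open>g (\<pi>/2) > 0\<close>.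
\<close>

section \<open>Functions that cross zero upwards at most once\<close>

definition crosses_upwards :: "real \<Rightarrow> (real \<Rightarrow> real) \<Rightarrow> bool" where
  "crosses_upwards b f \<longleftrightarrow> (\<forall>s t. 0 < s \<longrightarrow> s < t \<longrightarrow> t \<le> b \<longrightarrow> 0 \<le> f s \<longrightarrow> 0 < f t)"

text \<open>If \<open>f s\<close> is nonnegative, the mean value theorem on \<open>[0, s]\<close> finds a point where \<open>f'\<close> is
  nonnegative. Beyond that point \<open>f'\<close> is positive, so \<open>f\<close> increases strictly from \<open>s\<close> on.\<close>

lemma crosses_upwards_primitive:
  assumes cross: "crosses_upwards b f'"
    and zero: "f 0 = 0"
    and der: "\<And>x. (f has_real_derivative f' x) (at x)"
  shows "crosses_upwards b f"
  unfolding crosses_upwards_def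
proof (intro allI impI)
  fix s t :: real
  assume st: "0 < s" "s < t" "t \<le> b" "0 \<le> f s"
  obtain u where u: "0 < u" "u < s" "f s - f 0 = (s - 0) * f' u"
    using MVT2[of 0 s f f'] st(1) der by blast
  have "0 \<le> f' u"
    using u st zero by (simp add: zero_le_mult_iff)
  then have "0 < f' y" if "s \<le> y" "y \<le> t" for y
    using cross u st that unfolding crosses_upwards_def by (meson le_less_trans less_le_trans order_trans)
  then have "f s < f t"
    using DERIV_pos_imp_increasing[of s t f] st(2) der by blast
  then show "0 < f t"
    using st(4) by simp
qed

lemma crosses_upwards_mult_increasing:
  assumes pos: "\<And>x. 0 < x \<Longrightarrow> x \<le> b \<Longrightarrow> 0 < p x"
    and incr: "\<And>s t. 0 < s \<Longrightarrow> s < t \<Longrightarrow> t \<le> b \<Longrightarrow> q s < q t"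
    and eq: "\<And>x. 0 < x \<Longrightarrow> x \<le> b \<Longrightarrow> f x = p x * q x"
  shows "crosses_upwards b f"
  unfolding crosses_upwards_def
proof (intro allI impI)
  fix s t :: real
  assume st: "0 < s" "s < t" "t \<le> b" "0 \<le> f s"
  then have "0 \<le> q s"
    using eq[of s] pos[of s] by (simp add: zero_le_mult_iff)
  then have "0 < q t"
    using incr st by force
  then show "0 < f t"
    using eq[of t] pos[of t] st by simp
qed

lemma crosses_upwards_imp_neg:
  assumes "crosses_upwards b f" "f b = 0" "0 < x" "x < b"
  shows "f x < 0"
  using assms unfolding crosses_upwards_def by (metis less_irrefl not_le order_refl)

section \<open>Elementary estimates on the interval up to a right angle\<close>

lemma pos_if_deriv_pos:
  fixes f :: "real \<Rightarrow> real"
  assumes "f 0 = 0" "0 < x"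
    and der: "\<And>y. (f has_real_derivative f' y) (at y)"
    and pos: "\<And>y. 0 < y \<Longrightarrow> y < x \<Longrightarrow> 0 < f' y"
  shows "0 < f x"
proof -
  obtain u where "0 < u" "u < x" "f x - f 0 = (x - 0) * f' u"
    using MVT2[of 0 x f f'] assms by blast
  then show ?thesis
    using assms by simp
qed

lemma sin_pos_right_angle: "0 < x \<Longrightarrow> x \<le> pi / 2 \<Longrightarrow> 0 < sin x"
  by (rule sin_gt_zero) (use pi_gt_zero in linarith)+

lemma cos_nonneg_right_angle: "0 < x \<Longrightarrow> x \<le> pi / 2 \<Longrightarrow> 0 \<le> cos x"
  by (rule cos_ge_zero) (use pi_gt_zero in linarith)+

lemma Psi1_has_derivative: "(Psi1 has_real_derivative x * sin x) (at x)"
  unfolding Psi1_def [abs_def]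
  by (auto intro!: derivative_eq_intros simp: algebra_simps)

lemma Psi1_pos:
  assumes "0 < x" "x \<le> pi / 2"
  shows "0 < Psi1 x"
  by (rule pos_if_deriv_pos[where f = Psi1 and f' = "\<lambda>y. y * sin y"])
    (use assms Psi1_has_derivative sin_pos_right_angle in \<open>auto simp: Psi1_def\<close>)

text \<open>Both sides vanish at \<open>0\<close>, and the difference has derivative \<open>x \<Psi> x\<close>.\<close>

lemma x_cos_less_sin:
  assumes "0 < x" "x \<le> pi / 2"
  shows "3 * x * cos x < (3 - x\<^sup>2) * sin x"
proof -
  have "0 < (3 - x\<^sup>2) * sin x - 3 * x * cos x"
  proof (rule pos_if_deriv_pos[where f = "\<lambda>y. (3 - y\<^sup>2) * sin y - 3 * y * cos y"
        and f' = "\<lambda>y. y * Psi1 y"])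
    show "((\<lambda>y. (3 - y\<^sup>2) * sin y - 3 * y * cos y) has_real_derivative y * Psi1 y) (at y)" for y :: real
      by (auto intro!: derivative_eq_intros simp: Psi1_def algebra_simps power2_eq_square)
  qed (use assms Psi1_pos in auto)
  then show ?thesis by simp
qed

lemma square_less_3:
  assumes "0 < x" "x \<le> pi / 2"
  shows "x\<^sup>2 < 3"
proof -
  have "0 \<le> 3 * x * cos x"
    using assms cos_nonneg_right_angle by simp
  then have "0 < (3 - x\<^sup>2) * sin x"
    using x_cos_less_sin[OF assms] by simp
  then show ?thesis
    using sin_pos_right_angle[OF assms] by (simp add: zero_less_mult_iff)
qed

text \<open>At \<open>\<pi>/2\<close> the function \<open>2 x + x cos x - 3 sin x\<close> has the value \<open>\<pi> - 3\<close>, and it is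
  positive since its second derivative is \<open>\<Psi>\<close>.\<close>

lemma pi_greater_3: "3 < pi"
proof -
  have d: "0 < 2 - 2 * cos y - y * sin y" if "0 < y" "y < pi / 2" for y :: real
  proof (rule pos_if_deriv_pos[where f = "\<lambda>y. 2 - 2 * cos y - y * sin y" and f' = Psi1])
    show "((\<lambda>y. 2 - 2 * cos y - y * sin y) has_real_derivative Psi1 y) (at y)" for y
      by (auto intro!: derivative_eq_intros simp: Psi1_def algebra_simps)
  qed (use that Psi1_pos in auto)
  have "0 < 2 * (pi / 2) + pi / 2 * cos (pi / 2) - 3 * sin (pi / 2)"
  proof (rule pos_if_deriv_pos[where f = "\<lambda>y. 2 * y + y * cos y - 3 * sin y"
        and f' = "\<lambda>y. 2 - 2 * cos y - y * sin y"])
    show "((\<lambda>y. 2 * y + y * cos y - 3 * sin y) has_real_derivative 2 - 2 * cos y - y * sin y) (at y)"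
      for y :: real
      by (auto intro!: derivative_eq_intros simp: algebra_simps)
  qed (use d in auto)
  then show ?thesis by simp
qed

section \<open>The two monotone factors\<close>

text \<open>The derivative is \<open>(sin x cos x - x) / sin\<^sup>2 x\<close>, and \<open>sin x cos x \<le> sin x \<le> x\<close>.\<close>

lemma x_cot_decreasing:
  fixes s t :: real
  assumes "0 < s" "s \<le> t" "t \<le> pi / 2"
  shows "t * cos t / sin t \<le> s * cos s / sin s"
proof (rule DERIV_nonpos_imp_nonincreasing[OF \<open>s \<le> t\<close>])
  fix y assume "s \<le> y" "y \<le> t"
  then have y: "0 < y" "y \<le> pi / 2" using assms by auto
  note sn = sin_pos_right_angle[OF y]
  have "sin y * cos y \<le> sin y * 1"
    using sn by (intro mult_left_mono) auto
  then have "sin y * cos y \<le> y"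
    using sin_x_le_x[of y] y by linarith
  moreover have "((\<lambda>y. y * cos y / sin y) has_real_derivative (sin y * cos y - y) / (sin y)\<^sup>2) (at y)"
  proof -
    have "y * (cos y)\<^sup>2 = y - y * (sin y)\<^sup>2"
      by (simp add: cos_squared_eq algebra_simps)
    then show ?thesis
      using sn
      by (auto intro!: derivative_eq_intros simp: field_simps power2_eq_square)
  qed
  ultimately show "\<exists>d. ((\<lambda>y. y * cos y / sin y) has_real_derivative d) (at y) \<and> d \<le> 0"
    using sn by (intro exI conjI) (auto simp: divide_le_0_iff)
qed

text \<open>This is the numerator of the derivative of \<open>x\<^sup>3 sin\<^sup>2 x / \<Psi> x\<close>, up to the factor
  \<open>x\<^sup>2 sin x\<close>. Divided by \<open>sin\<^sup>2 x\<close> and written with \<open>w = x cot x\<close> it is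
  \<open>3 - w - 2 w\<^sup>2 - x\<^sup>2\<close>. It decreases in \<open>w \<ge> 0\<close>, so \<open>w\<close> may be replaced by its upper bound
  \<open>1 - x\<^sup>2 / 3\<close>, which leaves \<open>2 x\<^sup>2 (3 - x\<^sup>2) / 9\<close>.\<close>

lemma quotient_numerator_pos:
  fixes x :: real
  assumes "0 < x" "x \<le> pi / 2"
  shows "0 < (3 * sin x + 2 * x * cos x) * Psi1 x - x\<^sup>2 * (sin x)\<^sup>2"
proof -
  note sn = sin_pos_right_angle[OF assms]
  define w where "w = x * cos x / sin x"
  have xc: "x * cos x = w * sin x"
    using sn by (simp add: w_def)
  have w0: "0 \<le> w"
    using sn assms cos_nonneg_right_angle[OF assms] by (simp add: w_def)
  have "3 * w * sin x < (3 - x\<^sup>2) * sin x"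
    using x_cos_less_sin[OF assms] xc by simp
  then have w1: "w < 1 - x\<^sup>2 / 3"
    using sn by simp
  then have "w\<^sup>2 \<le> (1 - x\<^sup>2 / 3)\<^sup>2"
    using w0 by (intro power_mono) auto
  moreover have "3 - (1 - x\<^sup>2 / 3) - 2 * (1 - x\<^sup>2 / 3)\<^sup>2 - x\<^sup>2 = 2 * x\<^sup>2 * (3 - x\<^sup>2) / 9"
    by (simp add: power2_eq_square field_simps)
  moreover have "0 < 2 * x\<^sup>2 * (3 - x\<^sup>2) / 9"
    using square_less_3[OF assms] assms by simp
  ultimately have "0 < 3 - w - 2 * w\<^sup>2 - x\<^sup>2"
    using w1 by linarith
  then have "0 < (sin x)\<^sup>2 * (3 - w - 2 * w\<^sup>2 - x\<^sup>2)"
    using sn by simp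
  also have "\<dots> = (3 * sin x + 2 * (x * cos x)) * (sin x - x * cos x) - x\<^sup>2 * (sin x)\<^sup>2"
    unfolding xc by (simp add: power2_eq_square algebra_simps)
  finally show ?thesis
    by (simp add: Psi1_def mult.assoc)
qed

lemma quotient_strict_increasing:
  fixes s t :: real
  assumes "0 < s" "s < t" "t \<le> pi / 2"
  shows "s ^ 3 * (sin s)\<^sup>2 / Psi1 s < t ^ 3 * (sin t)\<^sup>2 / Psi1 t"
proof (rule DERIV_pos_imp_increasing[OF \<open>s < t\<close>])
  fix y assume "s \<le> y" "y \<le> t"
  then have y: "0 < y" "y \<le> pi / 2" using assms by auto
  let ?N = "(3 * sin y + 2 * y * cos y) * Psi1 y - y\<^sup>2 * (sin y)\<^sup>2"
  have "((\<lambda>y. y ^ 3 * (sin y)\<^sup>2 / Psi1 y) has_real_derivative y\<^sup>2 * sin y * ?N / (Psi1 y)\<^sup>2) (at y)"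
    using Psi1_pos[OF y]
    by (auto intro!: derivative_eq_intros Psi1_has_derivative
        simp: field_simps power2_eq_square power3_eq_cube)
  moreover have "0 < y\<^sup>2 * sin y * ?N / (Psi1 y)\<^sup>2"
    using quotient_numerator_pos[OF y] Psi1_pos[OF y] sin_pos_right_angle[OF y] y by simp
  ultimately show "\<exists>d. ((\<lambda>y. y ^ 3 * (sin y)\<^sup>2 / Psi1 y) has_real_derivative d) (at y) \<and> 0 < d"
    by blast
qed

lemma sin_cos_part_strict_increasing:
  fixes s t :: real
  assumes "0 < s" "s < t" "t \<le> pi / 2"
  shows "6 * s * sin s + 2 * s\<^sup>2 * cos s < 6 * t * sin t + 2 * t\<^sup>2 * cos t"
proof (rule DERIV_pos_imp_increasing[OF \<open>s < t\<close>])
  fix y assume "s \<le> y" "y \<le> t"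
  then have y: "0 < y" "y \<le> pi / 2" using assms by auto
  have "((\<lambda>y. 6 * y * sin y + 2 * y\<^sup>2 * cos y) has_real_derivative
      2 * (3 - y\<^sup>2) * sin y + 10 * y * cos y) (at y)"
    by (auto intro!: derivative_eq_intros simp: algebra_simps power2_eq_square)
  moreover have "0 < 2 * (3 - y\<^sup>2) * sin y"
    using square_less_3[OF y] sin_pos_right_angle[OF y] by simp
  moreover have "0 \<le> 10 * y * cos y"
    using cos_nonneg_right_angle[OF y] y by simp
  ultimately show "\<exists>d. ((\<lambda>y. 6 * y * sin y + 2 * y\<^sup>2 * cos y) has_real_derivative d) (at y) \<and> 0 < d"
    by (meson add_pos_nonneg)
qed

section \<open>The two inequalities without denominators\<close>

lemma numerator_less:
  fixes x :: real
  assumes x: "0 < x" "x < pi / 2"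
  shows "2 * x + x * cos x - 3 * sin x < (2 - 6 / pi) * x * Psi1 x"
proof -
  define K where "K = 2 - 6 / pi"
  have K: "0 < K"
    using pi_greater_3 by (simp add: K_def field_simps)
  define f where "f x = 2 * x + x * cos x - 3 * sin x - K * x * Psi1 x" for x
  define f1 where "f1 x = 2 - 2 * cos x - x * sin x - K * (Psi1 x + x\<^sup>2 * sin x)" for x
  define f2 where "f2 x = Psi1 x - K * (3 * x * sin x + x\<^sup>2 * cos x)" for x
  define f3 where "f3 x = x * sin x - K * (3 * sin x + 5 * x * cos x - x\<^sup>2 * sin x)" for x
  have "crosses_upwards (pi / 2) f3"
  proof (rule crosses_upwards_mult_increasing)
    show "s + K * s\<^sup>2 - 3 * K - 5 * K * (s * cos s / sin s)
        < t + K * t\<^sup>2 - 3 * K - 5 * K * (t * cos t / sin t)"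
      if "0 < s" "s < t" "t \<le> pi / 2" for s t
    proof -
      have "K * s\<^sup>2 \<le> K * t\<^sup>2"
        using K that by (intro mult_left_mono power_mono) auto
      moreover have "5 * K * (t * cos t / sin t) \<le> 5 * K * (s * cos s / sin s)"
        using K x_cot_decreasing[of s t] that by (intro mult_left_mono) auto
      ultimately show ?thesis
        using that by linarith
    qed
    show "f3 y = sin y * (y + K * y\<^sup>2 - 3 * K - 5 * K * (y * cos y / sin y))"
      if "0 < y" "y \<le> pi / 2" for y
      using sin_pos_right_angle[OF that] by (simp add: f3_def field_simps)
  qed (rule sin_pos_right_angle)
  then have "crosses_upwards (pi / 2) f2"
  proof (rule crosses_upwards_primitive)
    show "(f2 has_real_derivative f3 y) (at y)" for y
      unfolding f2_def f3_def
      by (auto intro!: derivative_eq_intros Psi1_has_derivative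
          simp: algebra_simps power2_eq_square)
  qed (simp add: f2_def Psi1_def)
  then have "crosses_upwards (pi / 2) f1"
  proof (rule crosses_upwards_primitive)
    show "(f1 has_real_derivative f2 y) (at y)" for y
      unfolding f1_def f2_def
      by (auto intro!: derivative_eq_intros Psi1_has_derivative
          simp: Psi1_def algebra_simps power2_eq_square)
  qed (simp add: f1_def Psi1_def)
  then have "crosses_upwards (pi / 2) f"
  proof (rule crosses_upwards_primitive)
    show "(f has_real_derivative f1 y) (at y)" for y
      unfolding f_def f1_def
      by (auto intro!: derivative_eq_intros Psi1_has_derivative
          simp: algebra_simps power2_eq_square)
  qed (simp add: f_def)
  moreover have "f (pi / 2) = 0"
    by (simp add: f_def K_def Psi1_def field_simps)
  ultimately have "f x < 0"
    using x by (rule crosses_upwards_imp_neg)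
  then show ?thesis
    by (simp add: f_def K_def)
qed

lemma less_numerator:
  fixes x :: real
  assumes x: "0 < x" "x < pi / 2"
  shows "(2 - 6 / pi) * x * (Psi1 x)\<^sup>2 < 2 * x + x * cos x - 3 * sin x"
proof -
  define K where "K = 2 - 6 / pi"
  have K: "0 < K"
    using pi_greater_3 by (simp add: K_def field_simps)
  define f where "f x = K * x * (Psi1 x)\<^sup>2 - (2 * x + x * cos x - 3 * sin x)" for x
  define f1 where "f1 x = K * ((Psi1 x)\<^sup>2 + 2 * x\<^sup>2 * sin x * Psi1 x)
      - (2 - 2 * cos x - x * sin x)" for x
  define f2 where "f2 x = K * ((6 * x * sin x + 2 * x\<^sup>2 * cos x) * Psi1 x
      + 2 * (x ^ 3 * (sin x)\<^sup>2)) - Psi1 x" for x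
  have "crosses_upwards (pi / 2) f2"
  proof (rule crosses_upwards_mult_increasing)
    show "K * (6 * s * sin s + 2 * s\<^sup>2 * cos s + 2 * (s ^ 3 * (sin s)\<^sup>2 / Psi1 s)) - 1
        < K * (6 * t * sin t + 2 * t\<^sup>2 * cos t + 2 * (t ^ 3 * (sin t)\<^sup>2 / Psi1 t)) - 1"
      if "0 < s" "s < t" "t \<le> pi / 2" for s t
      using quotient_strict_increasing[OF that] sin_cos_part_strict_increasing[OF that] K
      by (intro diff_strict_right_mono mult_strict_left_mono) linarith+
    show "f2 y = Psi1 y *
        (K * (6 * y * sin y + 2 * y\<^sup>2 * cos y + 2 * (y ^ 3 * (sin y)\<^sup>2 / Psi1 y)) - 1)"
      if "0 < y" "y \<le> pi / 2" for y
      using Psi1_pos[OF that] by (simp add: f2_def field_simps)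
  qed (rule Psi1_pos)
  then have "crosses_upwards (pi / 2) f1"
  proof (rule crosses_upwards_primitive)
    show "(f1 has_real_derivative f2 y) (at y)" for y
      unfolding f1_def f2_def
      by (auto intro!: derivative_eq_intros Psi1_has_derivative
          simp: Psi1_def algebra_simps power2_eq_square power3_eq_cube)
  qed (simp add: f1_def Psi1_def)
  then have "crosses_upwards (pi / 2) f"
  proof (rule crosses_upwards_primitive)
    show "(f has_real_derivative f1 y) (at y)" for y
      unfolding f_def f1_def
      by (auto intro!: derivative_eq_intros Psi1_has_derivative
          simp: algebra_simps power2_eq_square)
  qed (simp add: f_def)
  moreover have "f (pi / 2) = 0"
    by (simp add: f_def K_def Psi1_def field_simps)
  ultimately have "f x < 0"
    using x by (rule crosses_upwards_imp_neg)
  then show ?thesis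
    by (simp add: f_def K_def)
qed

section \<open>The double inequality\<close>

theorem theorem2:
  fixes x :: real
  assumes "x \<in> {0<..<pi / 2}"
  shows "(2 + cos x) / 3 - (2 / 3 - 2 / pi) * Psi1 x < sin x / x
       \<and> sin x / x < (2 + cos x) / 3 - (2 / 3 - 2 / pi) * Psi2 x"
proof -
  have x: "0 < x" "x < pi / 2"
    using assms by auto
  have common: "(2 + cos x) / 3 - (2 / 3 - 2 / pi) * P - sin x / x
      = (2 * x + x * cos x - 3 * sin x - (2 - 6 / pi) * x * P) / (3 * x)" for P
    using x by (simp add: field_simps)
  have "(2 + cos x) / 3 - (2 / 3 - 2 / pi) * Psi1 x - sin x / x < 0"
    unfolding common using numerator_less[OF x] x by (simp add: divide_less_0_iff)
  moreover have "0 < (2 + cos x) / 3 - (2 / 3 - 2 / pi) * Psi2 x - sin x / x"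
    unfolding common using less_numerator[OF x] x by (simp add: Psi1_def Psi2_def)
  ultimately show ?thesis
    by simp
qed

end
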